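(* Let $F^n=(M,F)$ be a Finsler space, $i:\check M\to M$ an immersed $m$-dimensional manifold ($1<m<n$), and $D$ the Cartan metrical $N$-linear connection on $\widetilde{OscM}$. The tangent connection 1-forms $\omega^{H\,\alpha}{}_\beta,\omega^{V\,\alpha}{}_\beta$ of the induced tangent connection on $\widetilde{Osc\check M}$ are $$\omega^{H\,\alpha}{}_\beta=L^{H\,\alpha}{}_{\beta\delta}\,du^\delta+C^{H\,\alpha}{}_{\beta\delta}\,\delta v^\delta,\qquad \omega^{V\,\alpha}{}_\beta=L^{V\,\alpha}{}_{\beta\delta}\,du^\delta+C^{V\,\alpha}{}_{\beta\delta}\,\delta v^\delta,$$ where $$L^{H\,\alpha}{}_{\beta\delta}=B^\alpha_d\left(B^d_{\beta\delta}+B^f_\beta\check L^{H\,d}{}_{f\delta}\right),\qquad L^{V\,\alpha}{}_{\beta\delta}=B^\alpha_d\left(B^d_{\beta\delta}+B^f_\beta\check L^{V\,d}{}_{f\delta}\right),$$ $$C^{H\,\alpha}{}_{\beta\delta}=B^\alpha_dB^f_\beta\check C^{H\,d}{}_{f\delta},\qquad C^{V\,\alpha}{}_{\beta\delta}=B^\alpha_dB^f_\beta\check C^{V\,d}{}_{f\delta}.$$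
   Context: Summation convention throughout. Indices $a,b,c,d,f$ run over $1,\dots,n$; $\alpha,\beta,\gamma,\delta$ over $1,\dots,m$; barred indices over $1,\dots,n-m$. Ambient space. $M$ is a real $n$-manifold, $OscM=TM$ with local coordinates $(x^a,y^a)$, $\widetilde{OscM}=TM\setminus\{0\}$. $F$ is a Finsler fundamental function on $M$ (smooth on $\widetilde{OscM}$, continuous on the null section), $g_{ab}=\frac12\frac{\partial^2F^2}{\partial y^a\partial y^b}$, $\gamma^a_{bc}(x,y)$ are the Christoffel symbols of $g_{ab}$ formed with $x$-derivatives, $G^a=\frac12\gamma^a_{bc}y^by^c$, and $N^a{}_b=\partial G^a/\partial y^b$ is the Cartan nonlinear connection. Put $\dot\partial_a=\partial/\partial y^a$, $\delta_a=\partial/\partial x^a-N^b{}_a\dot\partial_b$, $\delta y^a=dy^a+N^a{}_bdx^b$. Let $p>0$ be a constant, $\|y\|^2=g_{ab}y^ay^b$, $h_{ab}=\frac{p^2}{\|y\|^2}g_{ab}$, with inverse $h^{ab}$. The Cartan metrical $N$-linear connection $D$ (of the lift $g_{ab}dx^a\otimes dx^b+h_{ab}\delta y^a\otimes\delta y^b$) has the coefficients $L^{H\,a}{}_{bc}=\frac12g^{ad}(\delta_bg_{dc}+\delta_cg_{bd}-\delta_dg_{bc})$, $L^{V\,a}{}_{bc}=\frac12h^{ad}(\delta_bh_{dc}+\delta_ch_{bd}-\delta_dh_{bc})$, $C^{H\,a}{}_{bc}=\frac12g^{ad}(\dot\partial_bg_{dc}+\dot\partial_cg_{bd}-\dot\partial_dg_{bc})$,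 $C^{V\,a}{}_{bc}=\frac12h^{ad}(\dot\partial_bh_{dc}+\dot\partial_ch_{bd}-\dot\partial_dh_{bc})$. Submanifold. $i$ is locally $x^a=x^a(u^1,\dots,u^m)$ with $B^a_\alpha=\partial x^a/\partial u^\alpha$ of rank $m$; $Osc\check M=T\check M$ with coordinates $(u^\alpha,v^\alpha)$ is immersed in $OscM$ by $x^a=x^a(u)$, $y^a=B^a_\alpha v^\alpha$; $\widetilde{Osc\check M}=T\check M\setminus\{0\}$. Along it one fixes a local moving frame $\{B^a_\alpha(u),B^a_{\bar\alpha}(u,v)\}$ with dual frame $\{B^\alpha_a(u,v),B^{\bar\alpha}_a(u,v)\}$: $B^a_\beta B^\alpha_a=\delta^\alpha_\beta$, $B^a_\beta B^{\bar\alpha}_a=0$, $B^\alpha_aB^a_{\bar\beta}=0$, $B^{\bar\alpha}_aB^a_{\bar\beta}=\delta^{\bar\alpha}_{\bar\beta}$, $B^a_\alpha B^\alpha_b+B^a_{\bar\alpha}B^{\bar\alpha}_b=\delta^a_b$. Put $B^a_{\alpha\beta}=\partial^2x^a/\partial u^\alpha\partial u^\beta$, $B^a_{0\beta}=B^a_{\alpha\beta}v^\alpha$. The induced nonlinear connection is $\check N^\alpha{}_\beta=B^\alpha_a(B^a_{0\beta}+N^a{}_bB^b_\beta)$, $\delta v^\alpha=dv^\alpha+\check N^\alpha{}_\beta du^\beta$, and $K^{\bar\alpha}_\beta=B^{\bar\alpha}_a(B^a_{0\beta}+N^a{}_bB^b_\beta)$. (All ambient functions are evaluated along the submanifold.)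 Coupling. For $X^a$ defined along $\widetilde{Osc\check M}$, $\check D^HX^a=dX^a+\check\omega^{H\,a}{}_bX^b$ and $\check D^VX^a=dX^a+\check\omega^{V\,a}{}_bX^b$, where $\check\omega^{H\,a}{}_b=\check L^{H\,a}{}_{b\delta}du^\delta+\check C^{H\,a}{}_{b\delta}\delta v^\delta$, $\check\omega^{V\,a}{}_b=\check L^{V\,a}{}_{b\delta}du^\delta+\check C^{V\,a}{}_{b\delta}\delta v^\delta$, with $\check L^{H\,a}{}_{b\delta}=L^{H\,a}{}_{bd}B^d_\delta+C^{H\,a}{}_{bd}B^d_{\bar\delta}K^{\bar\delta}_\delta$, $\check L^{V\,a}{}_{b\delta}=L^{V\,a}{}_{bd}B^d_\delta+C^{V\,a}{}_{bd}B^d_{\bar\delta}K^{\bar\delta}_\delta$, $\check C^{H\,a}{}_{b\delta}=C^{H\,a}{}_{bd}B^d_\delta$, $\check C^{V\,a}{}_{b\delta}=C^{V\,a}{}_{bd}B^d_\delta$. Induced tangent connection. It is the pair of operators $D^{\top H},D^{\top V}$ defined by $D^{\top H}X^\alpha=B^\alpha_b\check D^HX^b$, $D^{\top V}X^\alpha=B^\alpha_b\check D^VX^b$ for $X^a=B^a_\gamma X^\gamma$. Its tangent connection 1-forms are the 1-forms $\omega^{H\,\alpha}{}_\beta,\omega^{V\,\alpha}{}_\beta$ with $D^{\top H}X^\alpha=dX^\alpha+X^\beta\omega^{H\,\alpha}{}_\beta$, $D^{\top V}X^\alpha=dX^\alpha+X^\beta\omega^{V\,\alpha}{}_\beta$ for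 all $X^\alpha$. *)

theory Defs
  imports "HOL-Analysis.Analysis"
begin

section \<open>Smooth maps and smooth manifolds\<close>

text \<open>\<open>Ck_on k S f\<close> is meant for open \<open>S\<close> in a finite-dimensional space, where it says that all
  partial derivatives of \<open>f\<close> up to order \<open>k\<close> exist and are continuous on \<open>S\<close>.\<close>

primrec Ck_on :: "nat \<Rightarrow> 'a::real_normed_vector set \<Rightarrow> ('a \<Rightarrow> 'b::real_normed_vector) \<Rightarrow> bool" where
  "Ck_on 0 S f \<longleftrightarrow> continuous_on S f"
| "Ck_on (Suc k) S f \<longleftrightarrow>
     f differentiable_on S \<and> (\<forall>v. Ck_on k S (\<lambda>z. frechet_derivative f (at z) v))"

definition smooth_on :: "'a::real_normed_vector set \<Rightarrow> ('a \<Rightarrow> 'b::real_normed_vector) \<Rightarrow> bool" where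
  "smooth_on S f \<longleftrightarrow> (\<forall>k. Ck_on k S f)"

text \<open>A chart is a pair of a domain and a coordinate map. The manifold itself is the whole of a
  Hausdorff second countable type.\<close>

type_synonym ('p, 'n) chart = "'p set \<times> ('p \<Rightarrow> real^'n)"

definition is_chart :: "('p::topological_space, 'n::finite) chart \<Rightarrow> bool" where
  "is_chart c \<longleftrightarrow> open (fst c) \<and> open (snd c ` fst c) \<and>
     homeomorphism (fst c) (snd c ` fst c) (snd c) (inv_into (fst c) (snd c))"

definition transition :: "('p, 'n) chart \<Rightarrow> ('p, 'n) chart \<Rightarrow> real^'n \<Rightarrow> real^'n::finite" where
  "transition c c' = snd c' \<circ> inv_into (fst c) (snd c)"

definition smooth_atlas ::
    "('p::{t2_space, second_countable_topology}, 'n::finite) chart set \<Rightarrow> bool" where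
  "smooth_atlas A \<longleftrightarrow> (\<forall>c\<in>A. is_chart c) \<and> (\<Union>c\<in>A. fst c) = UNIV \<and>
     (\<forall>c\<in>A. \<forall>c'\<in>A. smooth_on (snd c ` (fst c \<inter> fst c')) (transition c c'))"

text \<open>Points of a tangent bundle in the coordinates induced by a chart: \<open>(x, y)\<close> for the ambient
  space and \<open>(u, v)\<close> for the submanifold.\<close>

type_synonym 'n tpt = "(real^'n) \<times> (real^'n)"

definition pd :: "'n::finite \<Rightarrow> (real^'n \<Rightarrow> real) \<Rightarrow> real^'n \<Rightarrow> real" where
  "pd a f x = frechet_derivative f (at x) (axis a 1)"

definition pdx :: "'n::finite \<Rightarrow> ('n tpt \<Rightarrow> real) \<Rightarrow> 'n tpt \<Rightarrow> real" where
  "pdx a f z = frechet_derivative f (at z) (axis a 1, 0)"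

definition pdy :: "'n::finite \<Rightarrow> ('n tpt \<Rightarrow> real) \<Rightarrow> 'n tpt \<Rightarrow> real" where
  "pdy a f z = frechet_derivative f (at z) (0, axis a 1)"


section \<open>Finsler spaces\<close>

definition fund_g :: "('n::finite tpt \<Rightarrow> real) \<Rightarrow> 'n \<Rightarrow> 'n \<Rightarrow> 'n tpt \<Rightarrow> real" where
  "fund_g F a b z = 1/2 * pdy a (pdy b (\<lambda>w. (F w)\<^sup>2)) z"

text \<open>The usual axioms of a Finsler fundamental function, in coordinates over the open set \<open>V\<close>.\<close>

definition finsler_function_on :: "(real^'n::finite) set \<Rightarrow> ('n tpt \<Rightarrow> real) \<Rightarrow> bool" where
  "finsler_function_on V F \<longleftrightarrow>
     smooth_on (V \<times> (- {0})) F \<and>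
     continuous_on (V \<times> UNIV) F \<and>
     (\<forall>x\<in>V. \<forall>y. y \<noteq> 0 \<longrightarrow> F (x, y) > 0) \<and>
     (\<forall>x\<in>V. \<forall>y. \<forall>t>0. F (x, t *\<^sub>R y) = t * F (x, y)) \<and>
     (\<forall>x\<in>V. \<forall>y. y \<noteq> 0 \<longrightarrow>
        (\<forall>\<xi>::real^'n. \<xi> \<noteq> 0 \<longrightarrow> (\<Sum>a\<in>UNIV. \<Sum>b\<in>UNIV. fund_g F a b (x, y) * \<xi> $ a * \<xi> $ b) > 0))"

text \<open>A real function on the tangent bundle is given by its coordinate expressions \<open>F c\<close> in the
  charts \<open>c\<close> of the atlas; these agree under the tangent transition maps.\<close>

definition finsler_space ::
    "('p::{t2_space, second_countable_topology}, 'n::finite) chart set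
     \<Rightarrow> (('p, 'n) chart \<Rightarrow> 'n tpt \<Rightarrow> real) \<Rightarrow> bool" where
  "finsler_space A F \<longleftrightarrow> smooth_atlas A \<and>
     (\<forall>c\<in>A. finsler_function_on (snd c ` fst c) (F c)) \<and>
     (\<forall>c\<in>A. \<forall>c'\<in>A. \<forall>x\<in>snd c ` (fst c \<inter> fst c'). \<forall>y.
        F c' (transition c c' x, frechet_derivative (transition c c') (at x) y) = F c (x, y))"

definition gammaF :: "('n::finite tpt \<Rightarrow> real) \<Rightarrow> 'n \<Rightarrow> 'n \<Rightarrow> 'n \<Rightarrow> 'n tpt \<Rightarrow> real" where
  "gammaF F a b c z = 1/2 * (\<Sum>d\<in>UNIV. matrix_inv (\<chi> i j. fund_g F i j z) $ a $ d *
     (pdx b (fund_g F d c) z + pdx c (fund_g F b d) z - pdx d (fund_g F b c) z))"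

definition spray_G :: "('n::finite tpt \<Rightarrow> real) \<Rightarrow> 'n \<Rightarrow> 'n tpt \<Rightarrow> real" where
  "spray_G F a z = 1/2 * (\<Sum>b\<in>UNIV. \<Sum>c\<in>UNIV. gammaF F a b c z * snd z $ b * snd z $ c)"

definition conn_N :: "('n::finite tpt \<Rightarrow> real) \<Rightarrow> 'n \<Rightarrow> 'n \<Rightarrow> 'n tpt \<Rightarrow> real" where
  "conn_N F a b z = pdy b (spray_G F a) z"

definition delta_x ::
    "('n::finite tpt \<Rightarrow> real) \<Rightarrow> 'n \<Rightarrow> ('n tpt \<Rightarrow> real) \<Rightarrow> 'n tpt \<Rightarrow> real" where
  "delta_x F a f z = pdx a f z - (\<Sum>b\<in>UNIV. conn_N F b a z * pdy b f z)"

definition norm2_F :: "('n::finite tpt \<Rightarrow> real) \<Rightarrow> 'n tpt \<Rightarrow> real" where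
  "norm2_F F z = (\<Sum>a\<in>UNIV. \<Sum>b\<in>UNIV. fund_g F a b z * snd z $ a * snd z $ b)"

definition fund_h :: "('n::finite tpt \<Rightarrow> real) \<Rightarrow> real \<Rightarrow> 'n \<Rightarrow> 'n \<Rightarrow> 'n tpt \<Rightarrow> real" where
  "fund_h F p a b z = p\<^sup>2 / norm2_F F z * fund_g F a b z"

text \<open>Coefficients of the Cartan metrical \<open>N\<close>-linear connection; the index order is
  \<open>L a b c\<close> for the coefficient with upper index \<open>a\<close> and lower indices \<open>b c\<close>.\<close>

definition cartan_LH :: "('n::finite tpt \<Rightarrow> real) \<Rightarrow> 'n \<Rightarrow> 'n \<Rightarrow> 'n \<Rightarrow> 'n tpt \<Rightarrow> real" where
  "cartan_LH F a b c z = 1/2 * (\<Sum>d\<in>UNIV. matrix_inv (\<chi> i j. fund_g F i j z) $ a $ d *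
     (delta_x F b (fund_g F d c) z + delta_x F c (fund_g F b d) z - delta_x F d (fund_g F b c) z))"

definition cartan_LV :: "('n::finite tpt \<Rightarrow> real) \<Rightarrow> real \<Rightarrow> 'n \<Rightarrow> 'n \<Rightarrow> 'n \<Rightarrow> 'n tpt \<Rightarrow> real" where
  "cartan_LV F p a b c z = 1/2 * (\<Sum>d\<in>UNIV. matrix_inv (\<chi> i j. fund_h F p i j z) $ a $ d *
     (delta_x F b (fund_h F p d c) z + delta_x F c (fund_h F p b d) z
        - delta_x F d (fund_h F p b c) z))"

definition cartan_CH :: "('n::finite tpt \<Rightarrow> real) \<Rightarrow> 'n \<Rightarrow> 'n \<Rightarrow> 'n \<Rightarrow> 'n tpt \<Rightarrow> real" where
  "cartan_CH F a b c z = 1/2 * (\<Sum>d\<in>UNIV. matrix_inv (\<chi> i j. fund_g F i j z) $ a $ d *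
     (pdy b (fund_g F d c) z + pdy c (fund_g F b d) z - pdy d (fund_g F b c) z))"

definition cartan_CV :: "('n::finite tpt \<Rightarrow> real) \<Rightarrow> real \<Rightarrow> 'n \<Rightarrow> 'n \<Rightarrow> 'n \<Rightarrow> 'n tpt \<Rightarrow> real" where
  "cartan_CV F p a b c z = 1/2 * (\<Sum>d\<in>UNIV. matrix_inv (\<chi> i j. fund_h F p i j z) $ a $ d *
     (pdy b (fund_h F p d c) z + pdy c (fund_h F p b d) z - pdy d (fund_h F p b c) z))"


section \<open>Immersed submanifolds\<close>

text \<open>\<open>Bt x a \<alpha>\<close> are the first and \<open>Bt2 x a \<alpha> \<beta>\<close> the second partial derivatives of the \<open>a\<close>-th
  component of the coordinate expression \<open>x\<close> of the immersion.\<close>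

definition Bt :: "(real^'m::finite \<Rightarrow> real^'n::finite) \<Rightarrow> 'n \<Rightarrow> 'm \<Rightarrow> real^'m \<Rightarrow> real" where
  "Bt x a \<alpha> u = pd \<alpha> (\<lambda>w. x w $ a) u"

definition Bt2 :: "(real^'m::finite \<Rightarrow> real^'n::finite) \<Rightarrow> 'n \<Rightarrow> 'm \<Rightarrow> 'm \<Rightarrow> real^'m \<Rightarrow> real" where
  "Bt2 x a \<alpha> \<beta> u = pd \<alpha> (pd \<beta> (\<lambda>w. x w $ a)) u"

definition local_dom :: "('q, 'm::finite) chart \<Rightarrow> ('p, 'n::finite) chart \<Rightarrow> ('q \<Rightarrow> 'p) \<Rightarrow> (real^'m) set"
  where "local_dom c' c i = snd c' ` (fst c' \<inter> i -` fst c)"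

definition local_rep ::
    "('q, 'm::finite) chart \<Rightarrow> ('p, 'n::finite) chart \<Rightarrow> ('q \<Rightarrow> 'p) \<Rightarrow> real^'m \<Rightarrow> real^'n" where
  "local_rep c' c i = snd c \<circ> i \<circ> inv_into (fst c') (snd c')"

definition immersion ::
    "('q::topological_space, 'm::finite) chart set \<Rightarrow> ('p::topological_space, 'n::finite) chart set
     \<Rightarrow> ('q \<Rightarrow> 'p) \<Rightarrow> bool" where
  "immersion A' A i \<longleftrightarrow> continuous_on UNIV i \<and>
     (\<forall>c'\<in>A'. \<forall>c\<in>A. smooth_on (local_dom c' c i) (local_rep c' c i) \<and>
        (\<forall>u\<in>local_dom c' c i.
           rank (\<chi> a \<alpha>. Bt (local_rep c' c i) a \<alpha> u :: real^'m^'n) = CARD('m)))"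

definition osc_imm :: "(real^'m::finite \<Rightarrow> real^'n::finite) \<Rightarrow> 'm tpt \<Rightarrow> 'n tpt" where
  "osc_imm x q = (x (fst q), \<chi> a. \<Sum>\<alpha>\<in>UNIV. Bt x a \<alpha> (fst q) * snd q $ \<alpha>)"

text \<open>\<open>Bn a \<kappa>\<close> are the components of the transversal part of the frame, with barred index
  \<open>\<kappa>\<close>; \<open>Et \<alpha> a\<close> and \<open>En \<kappa> a\<close> are the tangent and transversal parts of the dual frame.\<close>

definition moving_frame ::
    "'m::finite tpt set \<Rightarrow> (real^'m \<Rightarrow> real^'n::finite) \<Rightarrow> ('n \<Rightarrow> 'k::finite \<Rightarrow> 'm tpt \<Rightarrow> real)
     \<Rightarrow> ('m \<Rightarrow> 'n \<Rightarrow> 'm tpt \<Rightarrow> real) \<Rightarrow> ('k \<Rightarrow> 'n \<Rightarrow> 'm tpt \<Rightarrow> real) \<Rightarrow> bool" where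
  "moving_frame W x Bn Et En \<longleftrightarrow>
     (\<forall>a \<kappa>. smooth_on W (Bn a \<kappa>)) \<and> (\<forall>\<alpha> a. smooth_on W (Et \<alpha> a)) \<and> (\<forall>\<kappa> a. smooth_on W (En \<kappa> a)) \<and>
     (\<forall>q\<in>W.
        (\<forall>\<alpha> \<beta>. (\<Sum>a\<in>UNIV. Bt x a \<beta> (fst q) * Et \<alpha> a q) = (if \<alpha> = \<beta> then 1 else 0)) \<and>
        (\<forall>\<kappa> \<beta>. (\<Sum>a\<in>UNIV. Bt x a \<beta> (fst q) * En \<kappa> a q) = 0) \<and>
        (\<forall>\<alpha> \<kappa>. (\<Sum>a\<in>UNIV. Et \<alpha> a q * Bn a \<kappa> q) = 0) \<and>
        (\<forall>\<kappa> \<mu>. (\<Sum>a\<in>UNIV. En \<kappa> a q * Bn a \<mu> q) = (if \<kappa> = \<mu> then 1 else 0)) \<and>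
        (\<forall>a b. (\<Sum>\<alpha>\<in>UNIV. Bt x a \<alpha> (fst q) * Et \<alpha> b q) + (\<Sum>\<kappa>\<in>UNIV. Bn a \<kappa> q * En \<kappa> b q)
               = (if a = b then 1 else 0)))"

text \<open>The common expression \<open>B0 + N B\<close>, whose tangent and transversal components are the induced
  nonlinear connection and the quantities \<open>K\<close>.\<close>

definition B0N ::
    "('n::finite tpt \<Rightarrow> real) \<Rightarrow> (real^'m::finite \<Rightarrow> real^'n) \<Rightarrow> 'n \<Rightarrow> 'm \<Rightarrow> 'm tpt \<Rightarrow> real" where
  "B0N F x a \<beta> q = (\<Sum>\<alpha>\<in>UNIV. Bt2 x a \<alpha> \<beta> (fst q) * snd q $ \<alpha>)
     + (\<Sum>b\<in>UNIV. conn_N F a b (osc_imm x q) * Bt x b \<beta> (fst q))"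

definition induced_N ::
    "('n::finite tpt \<Rightarrow> real) \<Rightarrow> (real^'m::finite \<Rightarrow> real^'n) \<Rightarrow> ('m \<Rightarrow> 'n \<Rightarrow> 'm tpt \<Rightarrow> real)
     \<Rightarrow> 'm \<Rightarrow> 'm \<Rightarrow> 'm tpt \<Rightarrow> real" where
  "induced_N F x Et \<alpha> \<beta> q = (\<Sum>a\<in>UNIV. Et \<alpha> a q * B0N F x a \<beta> q)"

definition trans_K ::
    "('n::finite tpt \<Rightarrow> real) \<Rightarrow> (real^'m::finite \<Rightarrow> real^'n) \<Rightarrow> ('k \<Rightarrow> 'n \<Rightarrow> 'm tpt \<Rightarrow> real)
     \<Rightarrow> 'k \<Rightarrow> 'm \<Rightarrow> 'm tpt \<Rightarrow> real" where
  "trans_K F x En \<kappa> \<beta> q = (\<Sum>a\<in>UNIV. En \<kappa> a q * B0N F x a \<beta> q)"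


section \<open>One-forms, the coupling and the induced tangent connection\<close>

text \<open>A 1-form assigns to each point a covector, i.e. a (bounded) linear functional on the
  coordinate tangent space.\<close>

type_synonym 'm oneform = "'m tpt \<Rightarrow> ('m tpt \<Rightarrow>\<^sub>L real)"

definition ext_d :: "('m::finite tpt \<Rightarrow> real) \<Rightarrow> 'm oneform" where
  "ext_d f q = Blinfun (frechet_derivative f (at q))"

definition du :: "'m::finite \<Rightarrow> 'm oneform" where
  "du \<alpha> = ext_d (\<lambda>q. fst q $ \<alpha>)"

definition dv :: "'m::finite \<Rightarrow> 'm oneform" where
  "dv \<alpha> = ext_d (\<lambda>q. snd q $ \<alpha>)"

definition delta_v ::
    "('n::finite tpt \<Rightarrow> real) \<Rightarrow> (real^'m::finite \<Rightarrow> real^'n) \<Rightarrow> ('m \<Rightarrow> 'n \<Rightarrow> 'm tpt \<Rightarrow> real)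
     \<Rightarrow> 'm \<Rightarrow> 'm oneform" where
  "delta_v F x Et \<alpha> q = dv \<alpha> q + (\<Sum>\<beta>\<in>UNIV. induced_N F x Et \<alpha> \<beta> q *\<^sub>R du \<beta> q)"

text \<open>The coupling is built the same way from \<open>(L, C) = (cartan_LH F, cartan_CH F)\<close> and from
  \<open>(L, C) = (cartan_LV F p, cartan_CV F p)\<close>.\<close>

definition coupling_L ::
    "('n::finite tpt \<Rightarrow> real) \<Rightarrow> (real^'m::finite \<Rightarrow> real^'n) \<Rightarrow> ('n \<Rightarrow> 'k::finite \<Rightarrow> 'm tpt \<Rightarrow> real)
     \<Rightarrow> ('k \<Rightarrow> 'n \<Rightarrow> 'm tpt \<Rightarrow> real)
     \<Rightarrow> ('n \<Rightarrow> 'n \<Rightarrow> 'n \<Rightarrow> 'n tpt \<Rightarrow> real) \<Rightarrow> ('n \<Rightarrow> 'n \<Rightarrow> 'n \<Rightarrow> 'n tpt \<Rightarrow> real)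
     \<Rightarrow> 'n \<Rightarrow> 'n \<Rightarrow> 'm \<Rightarrow> 'm tpt \<Rightarrow> real" where
  "coupling_L F x Bn En L C a b \<delta> q =
     (\<Sum>d\<in>UNIV. L a b d (osc_imm x q) * Bt x d \<delta> (fst q))
     + (\<Sum>d\<in>UNIV. \<Sum>\<kappa>\<in>UNIV. C a b d (osc_imm x q) * Bn d \<kappa> q * trans_K F x En \<kappa> \<delta> q)"

definition coupling_C ::
    "(real^'m::finite \<Rightarrow> real^'n::finite) \<Rightarrow> ('n \<Rightarrow> 'n \<Rightarrow> 'n \<Rightarrow> 'n tpt \<Rightarrow> real)
     \<Rightarrow> 'n \<Rightarrow> 'n \<Rightarrow> 'm \<Rightarrow> 'm tpt \<Rightarrow> real" where
  "coupling_C x C a b \<delta> q = (\<Sum>d\<in>UNIV. C a b d (osc_imm x q) * Bt x d \<delta> (fst q))"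

definition coupling_form ::
    "('n::finite tpt \<Rightarrow> real) \<Rightarrow> (real^'m::finite \<Rightarrow> real^'n) \<Rightarrow> ('n \<Rightarrow> 'k::finite \<Rightarrow> 'm tpt \<Rightarrow> real)
     \<Rightarrow> ('m \<Rightarrow> 'n \<Rightarrow> 'm tpt \<Rightarrow> real) \<Rightarrow> ('k \<Rightarrow> 'n \<Rightarrow> 'm tpt \<Rightarrow> real)
     \<Rightarrow> ('n \<Rightarrow> 'n \<Rightarrow> 'n \<Rightarrow> 'n tpt \<Rightarrow> real) \<Rightarrow> ('n \<Rightarrow> 'n \<Rightarrow> 'n \<Rightarrow> 'n tpt \<Rightarrow> real)
     \<Rightarrow> 'n \<Rightarrow> 'n \<Rightarrow> 'm oneform" where
  "coupling_form F x Bn Et En L C a b q =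
     (\<Sum>\<delta>\<in>UNIV. coupling_L F x Bn En L C a b \<delta> q *\<^sub>R du \<delta> q
              + coupling_C x C a b \<delta> q *\<^sub>R delta_v F x Et \<delta> q)"

definition coupling_D ::
    "('n::finite tpt \<Rightarrow> real) \<Rightarrow> (real^'m::finite \<Rightarrow> real^'n) \<Rightarrow> ('n \<Rightarrow> 'k::finite \<Rightarrow> 'm tpt \<Rightarrow> real)
     \<Rightarrow> ('m \<Rightarrow> 'n \<Rightarrow> 'm tpt \<Rightarrow> real) \<Rightarrow> ('k \<Rightarrow> 'n \<Rightarrow> 'm tpt \<Rightarrow> real)
     \<Rightarrow> ('n \<Rightarrow> 'n \<Rightarrow> 'n \<Rightarrow> 'n tpt \<Rightarrow> real) \<Rightarrow> ('n \<Rightarrow> 'n \<Rightarrow> 'n \<Rightarrow> 'n tpt \<Rightarrow> real)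
     \<Rightarrow> ('n \<Rightarrow> 'm tpt \<Rightarrow> real) \<Rightarrow> 'n \<Rightarrow> 'm oneform" where
  "coupling_D F x Bn Et En L C X a q =
     ext_d (X a) q + (\<Sum>b\<in>UNIV. X b q *\<^sub>R coupling_form F x Bn Et En L C a b q)"

definition tangent_D ::
    "('n::finite tpt \<Rightarrow> real) \<Rightarrow> (real^'m::finite \<Rightarrow> real^'n) \<Rightarrow> ('n \<Rightarrow> 'k::finite \<Rightarrow> 'm tpt \<Rightarrow> real)
     \<Rightarrow> ('m \<Rightarrow> 'n \<Rightarrow> 'm tpt \<Rightarrow> real) \<Rightarrow> ('k \<Rightarrow> 'n \<Rightarrow> 'm tpt \<Rightarrow> real)
     \<Rightarrow> ('n \<Rightarrow> 'n \<Rightarrow> 'n \<Rightarrow> 'n tpt \<Rightarrow> real) \<Rightarrow> ('n \<Rightarrow> 'n \<Rightarrow> 'n \<Rightarrow> 'n tpt \<Rightarrow> real)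
     \<Rightarrow> ('m \<Rightarrow> 'm tpt \<Rightarrow> real) \<Rightarrow> 'm \<Rightarrow> 'm oneform" where
  "tangent_D F x Bn Et En L C X \<alpha> q =
     (\<Sum>b\<in>UNIV. Et \<alpha> b q *\<^sub>R
        coupling_D F x Bn Et En L C (\<lambda>a w. \<Sum>\<gamma>\<in>UNIV. Bt x a \<gamma> (fst w) * X \<gamma> w) b q)"

text \<open>\<open>\<omega>\<close> is the family of connection 1-forms over \<open>W\<close> of an operator \<open>D\<close> acting on the components
  \<open>X\<close> of tangent vector fields.\<close>

definition connection_forms ::
    "'m::finite tpt set \<Rightarrow> (('m \<Rightarrow> 'm tpt \<Rightarrow> real) \<Rightarrow> 'm \<Rightarrow> 'm oneform)
     \<Rightarrow> ('m \<Rightarrow> 'm \<Rightarrow> 'm oneform) \<Rightarrow> bool" where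
  "connection_forms W D \<omega> \<longleftrightarrow>
     (\<forall>X. (\<forall>\<gamma>. smooth_on W (X \<gamma>)) \<longrightarrow>
        (\<forall>q\<in>W. \<forall>\<alpha>. D X \<alpha> q = ext_d (X \<alpha>) q + (\<Sum>\<beta>\<in>UNIV. X \<beta> q *\<^sub>R \<omega> \<alpha> \<beta> q)))"

end

theory Submission
  imports Defs
begin

text \<open>
  By the Leibniz rule, \<open>d (B\<^sup>b\<^sub>\<gamma> X\<^sup>\<gamma>) = B\<^sup>b\<^sub>\<gamma> dX\<^sup>\<gamma> + X\<^sup>\<gamma> B\<^sup>b\<^sub>\<delta>\<^sub>\<gamma> du\<^sup>\<delta>\<close>. Contracting with \<open>B\<^sup>\<alpha>\<^sub>b\<close>, duality of the
  frames leaves \<open>dX\<^sup>\<alpha>\<close> plus terms linear in \<open>X\<close>, and collecting the latter in \<open>du\<close> and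
  \<open>\<delta>v\<close> gives the claimed forms, up to the order of the two indices of \<open>B\<^sup>b\<^sub>\<delta>\<^sub>\<gamma>\<close>, which is immaterial
  because second partial derivatives of a smooth map commute. The forms are unique since the constant
  fields \<open>X\<^sup>\<gamma> = \<delta>\<^sup>\<gamma>\<^sub>\<beta>\<close> are admissible.
\<close>

lemma differentiable_on_openD:
  "f differentiable_on S \<Longrightarrow> open S \<Longrightarrow> z \<in> S \<Longrightarrow> f differentiable at z"
  by (simp add: differentiable_on_eq_differentiable_at)

lemma Ck_on_cong:
  assumes "open S" and "\<And>z. z \<in> S \<Longrightarrow> f z = g z" and "Ck_on k S f"
  shows "Ck_on k S g"
  using assms(2,3)
proof (induction k arbitrary: f g)
  case 0
  then show ?case
    by (auto cong: continuous_on_cong)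
next
  case (Suc k)
  have g: "(g has_derivative frechet_derivative f (at z)) (at z)" if "z \<in> S" for z
  proof (rule has_derivative_transform_within_open[OF _ assms(1) that Suc.prems(1)])
    show "(f has_derivative frechet_derivative f (at z)) (at z)"
      using Suc.prems that assms(1) by (auto intro: differentiable_on_openD simp flip: frechet_derivative_works)
  qed
  then have "frechet_derivative f (at z) = frechet_derivative g (at z)" if "z \<in> S" for z
    using that by (blast intro: frechet_derivative_at)
  moreover have "g differentiable_on S"
    using g by (auto simp: differentiable_on_def intro: differentiableI differentiable_at_withinI)
  ultimately show ?case
    using Suc.prems(2) Suc.IH[of "\<lambda>z. frechet_derivative f (at z) v" "\<lambda>z. frechet_derivative g (at z) v" for v]
    by auto
qed

lemma Ck_on_bounded_linear:
  assumes "bounded_linear h" and "open S" and "Ck_on k S f"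
  shows "Ck_on k S (\<lambda>z. h (f z))"
  using assms(3)
proof (induction k arbitrary: f)
  case 0
  then show ?case
    by (auto intro: bounded_linear.continuous_on[OF assms(1)])
next
  case (Suc k)
  have hf: "((\<lambda>z. h (f z)) has_derivative (\<lambda>v. h (frechet_derivative f (at z) v))) (at z)"
    if "z \<in> S" for z
    using Suc.prems that assms(2)
    by (auto intro!: bounded_linear.has_derivative[OF assms(1)]
        simp flip: frechet_derivative_works intro: differentiable_on_openD)
  have "Ck_on k S (\<lambda>z. frechet_derivative (\<lambda>z. h (f z)) (at z) v)" for v
  proof (rule Ck_on_cong[OF assms(2)])
    show "Ck_on k S (\<lambda>z. h (frechet_derivative f (at z) v))"
      using Suc by auto
  qed (use frechet_derivative_at[OF hf] in metis)
  moreover have "(\<lambda>z. h (f z)) differentiable_on S"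
    using hf by (auto simp: differentiable_on_def differentiable_def intro: has_derivative_at_withinI)
  ultimately show ?case
    by simp
qed

lemma smooth_on_const: "smooth_on S (\<lambda>_. c)"
proof -
  have "Ck_on k S (\<lambda>_. c)" for k
    by (induction k arbitrary: c) (auto simp: continuous_on_const)
  then show ?thesis
    by (simp add: smooth_on_def)
qed

lemma mvt_along_line:
  fixes f :: "'a::real_normed_vector \<Rightarrow> real"
  assumes "0 < s" and "\<And>t. 0 \<le> t \<Longrightarrow> t \<le> s \<Longrightarrow> f differentiable at (z + t *\<^sub>R v)"
  obtains t where "0 < t" "t < s"
    "f (z + s *\<^sub>R v) - f z = s * frechet_derivative f (at (z + t *\<^sub>R v)) v"
proof -
  have "((\<lambda>t. f (z + t *\<^sub>R v)) has_real_derivative frechet_derivative f (at (z + t *\<^sub>R v)) v) (at t)"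
    if "0 \<le> t" "t \<le> s" for t
  proof -
    have D: "(f has_derivative frechet_derivative f (at (z + t *\<^sub>R v))) (at (z + t *\<^sub>R v))"
      using assms(2)[OF that] by (simp add: frechet_derivative_works)
    have "((\<lambda>t. f (z + t *\<^sub>R v)) has_derivative
        (\<lambda>r. frechet_derivative f (at (z + t *\<^sub>R v)) (r *\<^sub>R v))) (at t)"
      by (rule has_derivative_compose[where f = "\<lambda>t. z + t *\<^sub>R v" and g = f, OF _ D]) (auto intro!: derivative_eq_intros)
    then show ?thesis
      using linear_cmul[OF has_derivative_linear[OF D]]
      by (simp add: has_field_derivative_def mult.commute[of _ "frechet_derivative f _ v"] mult_commute_abs)
  qed
  from MVT2[OF assms(1) this] show thesis
    using that by auto
qed

lemma second_difference:
  fixes f :: "'a::real_normed_vector \<Rightarrow> real"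
  assumes f: "\<And>y. y \<in> ball z r \<Longrightarrow> f differentiable at y"
    and f': "\<And>y. y \<in> ball z r \<Longrightarrow> (\<lambda>y. frechet_derivative f (at y) v) differentiable at y"
    and s: "0 < s" "s * (norm v + norm w) < r"
  obtains \<xi> where "dist z \<xi> \<le> s * (norm v + norm w)"
    "f (z + s *\<^sub>R v + s *\<^sub>R w) - f (z + s *\<^sub>R v) - f (z + s *\<^sub>R w) + f z =
      s\<^sup>2 * frechet_derivative (\<lambda>y. frechet_derivative f (at y) v) (at \<xi>) w"
proof -
  have near: "dist z (z + t *\<^sub>R v + t' *\<^sub>R w) \<le> s * (norm v + norm w)"
    if "0 \<le> t" "t \<le> s" "0 \<le> t'" "t' \<le> s" for t t'
  proof -
    have "dist z (z + t *\<^sub>R v + t' *\<^sub>R w) = norm (t *\<^sub>R v + t' *\<^sub>R w)"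
      by (metis add.assoc add_diff_cancel_left' dist_commute dist_norm)
    also have "\<dots> \<le> t * norm v + t' * norm w"
      using that norm_triangle_ineq[of "t *\<^sub>R v" "t' *\<^sub>R w"] by simp
    also have "\<dots> \<le> s * norm v + s * norm w"
      using that by (intro add_mono mult_right_mono) auto
    finally show ?thesis
      by (simp add: algebra_simps)
  qed
  have ball: "z + t *\<^sub>R v + t' *\<^sub>R w \<in> ball z r" if "0 \<le> t" "t \<le> s" "0 \<le> t'" "t' \<le> s" for t t'
    using near[OF that] s by simp
  have ball0: "z + t *\<^sub>R v \<in> ball z r" if "0 \<le> t" "t \<le> s" for t
    using ball[OF that, of 0] s by simp
  define g where "g y = f (y + s *\<^sub>R w) - f y" for y
  have Dg: "(g has_derivative (\<lambda>h. frechet_derivative f (at (y + s *\<^sub>R w)) h - frechet_derivative f (at y) h)) (at y)"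
    if "f differentiable at y" "f differentiable at (y + s *\<^sub>R w)" for y
  proof -
    have "((\<lambda>y. y + s *\<^sub>R w) has_derivative (\<lambda>h. h)) (at y)"
      by (auto intro!: derivative_eq_intros)
    from has_derivative_compose[OF this] that show ?thesis
      unfolding g_def by (intro has_derivative_diff) (simp_all add: frechet_derivative_works)
  qed
  have "g differentiable at (z + t *\<^sub>R v)" if "0 \<le> t" "t \<le> s" for t
    using Dg[OF f[OF ball0[OF that]] f[OF ball[OF that, of s]]] s differentiableI by auto
  from mvt_along_line[OF s(1) this] obtain t where t: "0 < t" "t < s"
    "g (z + s *\<^sub>R v) - g z = s * frechet_derivative g (at (z + t *\<^sub>R v)) v"
    by blast
  define y where "y = z + t *\<^sub>R v"
  have "f differentiable at y" "f differentiable at (y + s *\<^sub>R w)"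
    unfolding y_def using f ball ball0 t s by auto
  from frechet_derivative_at[OF Dg[OF this]]
  have 1: "frechet_derivative g (at y) v =
      frechet_derivative f (at (y + s *\<^sub>R w)) v - frechet_derivative f (at y) v"
    by metis
  have "(\<lambda>y. frechet_derivative f (at y) v) differentiable at (y + t' *\<^sub>R w)" if "0 \<le> t'" "t' \<le> s" for t'
    unfolding y_def using f' ball t that by auto
  from mvt_along_line[OF s(1) this] obtain t' where t': "0 < t'" "t' < s"
    "frechet_derivative f (at (y + s *\<^sub>R w)) v - frechet_derivative f (at y) v =
      s * frechet_derivative (\<lambda>y. frechet_derivative f (at y) v) (at (y + t' *\<^sub>R w)) w"
    by blast
  show thesis
  proof (rule that)
    show "dist z (y + t' *\<^sub>R w) \<le> s * (norm v + norm w)"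
      unfolding y_def using near t t' by simp
    have "f (z + s *\<^sub>R v + s *\<^sub>R w) - f (z + s *\<^sub>R v) - f (z + s *\<^sub>R w) + f z = g (z + s *\<^sub>R v) - g z"
      by (simp add: g_def)
    also have "\<dots> = s\<^sup>2 * frechet_derivative (\<lambda>y. frechet_derivative f (at y) v) (at (y + t' *\<^sub>R w)) w"
      using t(3) 1 t'(3) by (simp add: y_def power2_eq_square)
    finally show "f (z + s *\<^sub>R v + s *\<^sub>R w) - f (z + s *\<^sub>R v) - f (z + s *\<^sub>R w) + f z =
      s\<^sup>2 * frechet_derivative (\<lambda>y. frechet_derivative f (at y) v) (at (y + t' *\<^sub>R w)) w" .
  qed
qed

lemma frechet_derivative_commute:
  fixes f :: "'a::real_normed_vector \<Rightarrow> real"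
  assumes "open S" and "Ck_on 2 S f" and "z \<in> S"
  shows "frechet_derivative (\<lambda>y. frechet_derivative f (at y) v) (at z) w =
    frechet_derivative (\<lambda>y. frechet_derivative f (at y) w) (at z) v"
proof -
  define P where "P v w y = frechet_derivative (\<lambda>y. frechet_derivative f (at y) v) (at y) w" for v w y
  have f: "f differentiable at y" and f': "(\<lambda>y. frechet_derivative f (at y) v) differentiable at y"
    if "y \<in> S" for y v
    using assms that by (auto simp: numeral_2_eq_2 intro: differentiable_on_openD)
  have cont: "continuous_on S (P v w)" for v w
    using assms(2) by (simp add: numeral_2_eq_2 P_def)
  have "\<bar>P v w z - P w v z\<bar> \<le> e" if "e > 0" for e
  proof -
    have "\<exists>d>0. \<forall>y. dist y z < d \<longrightarrow> dist (P v w y) (P v w z) < e / 2" for v w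
      using cont[of v w] assms(1,3) that
      by (metis continuous_at_eps_delta continuous_on_eq_continuous_at half_gt_zero)
    then obtain d d' where d: "d > 0" "\<And>y. dist z y < d \<Longrightarrow> dist (P v w y) (P v w z) < e / 2"
      and d': "d' > 0" "\<And>y. dist z y < d' \<Longrightarrow> dist (P w v y) (P w v z) < e / 2"
      by (metis dist_commute)
    obtain r0 where r0: "r0 > 0" "ball z r0 \<subseteq> S"
      using assms(1,3) openE by blast
    define r where "r = min r0 (min d d')"
    define s where "s = r / (norm v + norm w + 1)"
    have r: "0 < r" "r \<le> r0" "r \<le> d" "r \<le> d'"
      using r0 d d' by (auto simp: r_def)
    have pos: "0 < norm v + norm w + 1"
      by (simp add: add_nonneg_pos)
    have s: "0 < s" "s * (norm v + norm w) < r" "s * (norm w + norm v) < r"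
      using r(1) pos by (auto simp: s_def field_simps)
    have ball: "y \<in> S" if "y \<in> ball z r" for y
      using that r r0 by auto
    obtain \<xi> where \<xi>: "dist z \<xi> \<le> s * (norm v + norm w)"
      "f (z + s *\<^sub>R v + s *\<^sub>R w) - f (z + s *\<^sub>R v) - f (z + s *\<^sub>R w) + f z = s\<^sup>2 * P v w \<xi>"
      using second_difference[OF f[OF ball] f'[OF ball] s(1,2)] unfolding P_def by blast
    obtain \<eta> where \<eta>: "dist z \<eta> \<le> s * (norm w + norm v)"
      "f (z + s *\<^sub>R w + s *\<^sub>R v) - f (z + s *\<^sub>R w) - f (z + s *\<^sub>R v) + f z = s\<^sup>2 * P w v \<eta>"
      using second_difference[OF f[OF ball] f'[OF ball] s(1,3)] unfolding P_def by blast
    have "s\<^sup>2 * P v w \<xi> = s\<^sup>2 * P w v \<eta>"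
      unfolding \<xi>(2)[symmetric] \<eta>(2)[symmetric] by (simp add: algebra_simps)
    then have "P v w \<xi> = P w v \<eta>"
      using s by simp
    moreover have "dist (P v w \<xi>) (P v w z) < e / 2" "dist (P w v \<eta>) (P w v z) < e / 2"
      using d(2) d'(2) \<xi>(1) \<eta>(1) s r by auto
    ultimately show ?thesis
      unfolding dist_real_def by linarith
  qed
  from field_le_epsilon[of "\<bar>P v w z - P w v z\<bar>" 0] this show ?thesis
    by (auto simp: P_def)
qed

lemma open_local_dom:
  assumes "is_chart c" and "is_chart c'" and "continuous_on UNIV i"
  shows "open (local_dom c' c i)"
proof -
  let ?\<psi> = "inv_into (fst c') (snd c')"
  have op: "open (snd c' ` fst c')" "open (fst c')" "open (fst c)"
    and hom: "homeomorphism (fst c') (snd c' ` fst c') (snd c') ?\<psi>"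
    using assms by (auto simp: is_chart_def)
  have "openin (top_of_set (fst c')) (fst c' \<inter> i -` fst c)"
    using op assms(3) by (simp add: openin_open_eq open_Int open_vimage)
  then have "openin (top_of_set (snd c' ` fst c')) (snd c' ` (fst c' \<inter> i -` fst c))"
    by (rule homeomorphism_imp_open_map[OF hom])
  then show ?thesis
    using op(1) by (auto simp: local_dom_def openin_open_eq)
qed

lemma ext_d_eqI: "(f has_derivative blinfun_apply L) (at q) \<Longrightarrow> ext_d f q = L"
  by (simp add: ext_d_def blinfun_apply_inverse flip: frechet_derivative_at)

lemma has_derivative_ext_d: "f differentiable at q \<Longrightarrow> (f has_derivative blinfun_apply (ext_d f q)) (at q)"
  by (simp add: ext_d_def frechet_derivative_works bounded_linear_Blinfun_apply has_derivative_bounded_linear)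

lemma ext_d_mult:
  assumes "f differentiable at q" and "g differentiable at q"
  shows "ext_d (\<lambda>w. f w * g w) q = f q *\<^sub>R ext_d g q + g q *\<^sub>R ext_d f q"
proof (rule ext_d_eqI)
  have "blinfun_apply (f q *\<^sub>R ext_d g q + g q *\<^sub>R ext_d f q) =
      (\<lambda>h. f q * blinfun_apply (ext_d g q) h + blinfun_apply (ext_d f q) h * g q)"
    by (auto simp: blinfun.bilinear_simps)
  then show "((\<lambda>w. f w * g w) has_derivative
      blinfun_apply (f q *\<^sub>R ext_d g q + g q *\<^sub>R ext_d f q)) (at q)"
    using has_derivative_mult[OF assms[THEN has_derivative_ext_d]] by simp
qed

lemma ext_d_sum:
  assumes "\<And>j. j \<in> I \<Longrightarrow> f j differentiable at q"
  shows "ext_d (\<lambda>w. \<Sum>j\<in>I. f j w) q = (\<Sum>j\<in>I. ext_d (f j) q)"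
proof (rule ext_d_eqI)
  have "blinfun_apply (\<Sum>j\<in>I. ext_d (f j) q) = (\<lambda>h. \<Sum>j\<in>I. blinfun_apply (ext_d (f j) q) h)"
    by (auto simp: blinfun.sum_left)
  then show "((\<lambda>w. \<Sum>j\<in>I. f j w) has_derivative blinfun_apply (\<Sum>j\<in>I. ext_d (f j) q)) (at q)"
    using has_derivative_sum[of I f] has_derivative_ext_d[OF assms] by simp
qed

lemma ext_d_const [simp]: "ext_d (\<lambda>_. k) q = 0"
  by (rule ext_d_eqI) (simp add: zero_blinfun.rep_eq)

lemma du_apply: "blinfun_apply (du \<delta> q) h = fst h $ \<delta>"
proof -
  have bl: "bounded_linear (\<lambda>h :: 'a tpt. fst h $ \<delta>)"
    by (intro bounded_linear_compose[OF bounded_linear_vec_nth bounded_linear_fst])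
  then have "du \<delta> q = Blinfun (\<lambda>h. fst h $ \<delta>)"
    unfolding du_def
    by (intro ext_d_eqI) (simp add: bounded_linear_Blinfun_apply bounded_linear_imp_has_derivative)
  then show ?thesis
    by (simp add: bounded_linear_Blinfun_apply[OF bl])
qed

lemma has_derivative_comp_fst:
  fixes q :: "'m::finite tpt" and f :: "real^'m \<Rightarrow> real"
  assumes "f differentiable at (fst q)"
  shows "((\<lambda>w. f (fst w)) has_derivative
    blinfun_apply (\<Sum>\<delta>\<in>UNIV. pd \<delta> f (fst q) *\<^sub>R du \<delta> q)) (at q)"
proof -
  let ?D = "frechet_derivative f (at (fst q))"
  have D: "(f has_derivative ?D) (at (fst q))"
    using assms by (simp add: frechet_derivative_works)
  note lin = has_derivative_linear[OF D]
  have "?D (fst h) = blinfun_apply (\<Sum>\<delta>\<in>UNIV. pd \<delta> f (fst q) *\<^sub>R du \<delta> q) h" for h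
  proof -
    have "?D (fst h) = ?D (\<Sum>\<delta>\<in>UNIV. fst h $ \<delta> *\<^sub>R axis \<delta> 1)"
      by (simp add: basis_expansion flip: scalar_mult_eq_scaleR)
    also have "\<dots> = (\<Sum>\<delta>\<in>UNIV. fst h $ \<delta> *\<^sub>R ?D (axis \<delta> 1))"
      by (simp add: linear_sum[OF lin] linear_cmul[OF lin])
    finally show ?thesis
      by (simp add: pd_def blinfun.bilinear_simps blinfun.sum_left du_apply mult.commute)
  qed
  then have "(\<lambda>h. ?D (fst h)) = blinfun_apply (\<Sum>\<delta>\<in>UNIV. pd \<delta> f (fst q) *\<^sub>R du \<delta> q)"
    by blast
  then show ?thesis
    using has_derivative_compose[OF has_derivative_fst[OF has_derivative_ident] D] by simp
qed

definition tangent_form ::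
    "('n::finite tpt \<Rightarrow> real) \<Rightarrow> (real^'m::finite \<Rightarrow> real^'n) \<Rightarrow> ('n \<Rightarrow> 'k::finite \<Rightarrow> 'm tpt \<Rightarrow> real)
     \<Rightarrow> ('m \<Rightarrow> 'n \<Rightarrow> 'm tpt \<Rightarrow> real) \<Rightarrow> ('k \<Rightarrow> 'n \<Rightarrow> 'm tpt \<Rightarrow> real)
     \<Rightarrow> ('n \<Rightarrow> 'n \<Rightarrow> 'n \<Rightarrow> 'n tpt \<Rightarrow> real) \<Rightarrow> ('n \<Rightarrow> 'n \<Rightarrow> 'n \<Rightarrow> 'n tpt \<Rightarrow> real)
     \<Rightarrow> 'm \<Rightarrow> 'm \<Rightarrow> 'm oneform" where
  "tangent_form F x Bn Et En L C \<alpha> \<beta> q =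
     (\<Sum>\<delta>\<in>UNIV.
        (\<Sum>d\<in>UNIV. Et \<alpha> d q * (Bt2 x d \<beta> \<delta> (fst q) +
           (\<Sum>f\<in>UNIV. Bt x f \<beta> (fst q) * coupling_L F x Bn En L C d f \<delta> q))) *\<^sub>R du \<delta> q
      + (\<Sum>d\<in>UNIV. \<Sum>f\<in>UNIV. Et \<alpha> d q * Bt x f \<beta> (fst q) * coupling_C x C d f \<delta> q)
          *\<^sub>R delta_v F x Et \<delta> q)"

lemma tangent_form_altdef:
  "tangent_form F x Bn Et En L C \<alpha> \<beta> q =
     (\<Sum>d\<in>UNIV. Et \<alpha> d q *\<^sub>R ((\<Sum>\<delta>\<in>UNIV. Bt2 x d \<beta> \<delta> (fst q) *\<^sub>R du \<delta> q)
        + (\<Sum>f\<in>UNIV. Bt x f \<beta> (fst q) *\<^sub>R coupling_form F x Bn Et En L C d f q)))"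
proof -
  let ?B2 = "\<lambda>d \<delta>. Bt2 x d \<beta> \<delta> (fst q)" and ?B = "\<lambda>f. Bt x f \<beta> (fst q)"
    and ?L = "\<lambda>d f \<delta>. coupling_L F x Bn En L C d f \<delta> q" and ?C = "\<lambda>d f \<delta>. coupling_C x C d f \<delta> q"
  have "(\<Sum>d\<in>UNIV. Et \<alpha> d q *\<^sub>R ((\<Sum>\<delta>\<in>UNIV. ?B2 d \<delta> *\<^sub>R du \<delta> q)
        + (\<Sum>f\<in>UNIV. ?B f *\<^sub>R coupling_form F x Bn Et En L C d f q))) =
      (\<Sum>d\<in>UNIV. \<Sum>\<delta>\<in>UNIV. (Et \<alpha> d q * (?B2 d \<delta> + (\<Sum>f\<in>UNIV. ?B f * ?L d f \<delta>))) *\<^sub>R du \<delta> q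
        + (\<Sum>f\<in>UNIV. Et \<alpha> d q * ?B f * ?C d f \<delta>) *\<^sub>R delta_v F x Et \<delta> q)"
  proof (rule sum.cong[OF refl])
    fix d
    have "(\<Sum>f\<in>UNIV. ?B f *\<^sub>R coupling_form F x Bn Et En L C d f q) =
        (\<Sum>f\<in>UNIV. \<Sum>\<delta>\<in>UNIV. (?B f * ?L d f \<delta>) *\<^sub>R du \<delta> q + (?B f * ?C d f \<delta>) *\<^sub>R delta_v F x Et \<delta> q)"
      by (simp add: coupling_form_def scaleR_sum_right scaleR_add_right)
    also have "\<dots> = (\<Sum>\<delta>\<in>UNIV. (\<Sum>f\<in>UNIV. ?B f * ?L d f \<delta>) *\<^sub>R du \<delta> q
        + (\<Sum>f\<in>UNIV. ?B f * ?C d f \<delta>) *\<^sub>R delta_v F x Et \<delta> q)"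
      by (subst sum.swap) (simp add: sum.distrib scaleR_sum_left)
    finally show "Et \<alpha> d q *\<^sub>R ((\<Sum>\<delta>\<in>UNIV. ?B2 d \<delta> *\<^sub>R du \<delta> q)
        + (\<Sum>f\<in>UNIV. ?B f *\<^sub>R coupling_form F x Bn Et En L C d f q)) =
      (\<Sum>\<delta>\<in>UNIV. (Et \<alpha> d q * (?B2 d \<delta> + (\<Sum>f\<in>UNIV. ?B f * ?L d f \<delta>))) *\<^sub>R du \<delta> q
        + (\<Sum>f\<in>UNIV. Et \<alpha> d q * ?B f * ?C d f \<delta>) *\<^sub>R delta_v F x Et \<delta> q)"
      by (simp add: scaleR_add_right scaleR_add_left scaleR_sum_right sum.distrib distrib_left
          mult.assoc flip: sum_distrib_left)
  qed
  also have "\<dots> = tangent_form F x Bn Et En L C \<alpha> \<beta> q"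
    unfolding tangent_form_def by (subst sum.swap) (simp add: sum.distrib scaleR_sum_left)
  finally show ?thesis
    by simp
qed

lemma tangent_D_eq:
  fixes x :: "real^'m::finite \<Rightarrow> real^'n::finite"
  assumes B: "\<And>a \<gamma>. Bt x a \<gamma> differentiable at (fst q)"
    and X: "\<And>\<gamma>. X \<gamma> differentiable at q"
    and dual: "\<And>\<beta>. (\<Sum>a\<in>UNIV. Bt x a \<beta> (fst q) * Et \<alpha> a q) = (if \<alpha> = \<beta> then 1 else 0)"
    and Bt2_commute: "\<And>a \<beta> \<delta>. Bt2 x a \<beta> \<delta> (fst q) = Bt2 x a \<delta> \<beta> (fst q)"
  shows "tangent_D F x Bn Et En L C X \<alpha> q =
    ext_d (X \<alpha>) q + (\<Sum>\<beta>\<in>UNIV. X \<beta> q *\<^sub>R tangent_form F x Bn Et En L C \<alpha> \<beta> q)"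
proof -
  let ?B = "\<lambda>a \<gamma>. Bt x a \<gamma> (fst q)"
    and ?cf = "\<lambda>a b. coupling_form F x Bn Et En L C a b q"
    and ?R = "\<lambda>b \<gamma>. (\<Sum>\<delta>\<in>UNIV. Bt2 x b \<gamma> \<delta> (fst q) *\<^sub>R du \<delta> q)"
  have dB: "(\<lambda>w. Bt x b \<gamma> (fst w)) differentiable at q"
    and ext_d_B: "ext_d (\<lambda>w. Bt x b \<gamma> (fst w)) q = ?R b \<gamma>" for b \<gamma>
  proof -
    have pd_Bt: "pd \<delta> (Bt x b \<gamma>) (fst q) = Bt2 x b \<gamma> \<delta> (fst q)" for \<delta>
      unfolding Bt2_commute[of b \<gamma> \<delta>] by (simp add: Bt2_def Bt_def[abs_def])
    note D = has_derivative_comp_fst[OF B[of b \<gamma>], unfolded pd_Bt]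
    show "(\<lambda>w. Bt x b \<gamma> (fst w)) differentiable at q"
      using D by (rule differentiableI)
    show "ext_d (\<lambda>w. Bt x b \<gamma> (fst w)) q = ?R b \<gamma>"
      using D by (rule ext_d_eqI)
  qed
  have "ext_d (\<lambda>w. \<Sum>\<gamma>\<in>UNIV. Bt x b \<gamma> (fst w) * X \<gamma> w) q =
      (\<Sum>\<gamma>\<in>UNIV. ?B b \<gamma> *\<^sub>R ext_d (X \<gamma>) q + X \<gamma> q *\<^sub>R ?R b \<gamma>)" for b
    by (subst ext_d_sum) (auto simp: ext_d_mult dB X ext_d_B intro!: differentiable_mult)
  note ext_d_BX = this
  have "coupling_D F x Bn Et En L C (\<lambda>a w. \<Sum>\<gamma>\<in>UNIV. Bt x a \<gamma> (fst w) * X \<gamma> w) b q =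
      (\<Sum>\<gamma>\<in>UNIV. ?B b \<gamma> *\<^sub>R ext_d (X \<gamma>) q)
      + (\<Sum>\<gamma>\<in>UNIV. X \<gamma> q *\<^sub>R (?R b \<gamma> + (\<Sum>f\<in>UNIV. ?B f \<gamma> *\<^sub>R ?cf b f)))" for b
  proof -
    have "(\<Sum>f\<in>UNIV. (\<Sum>\<gamma>\<in>UNIV. ?B f \<gamma> * X \<gamma> q) *\<^sub>R ?cf b f) =
        (\<Sum>\<gamma>\<in>UNIV. X \<gamma> q *\<^sub>R (\<Sum>f\<in>UNIV. ?B f \<gamma> *\<^sub>R ?cf b f))"
      unfolding scaleR_sum_left scaleR_sum_right
      by (subst sum.swap) (simp add: mult.commute)
    with ext_d_BX show ?thesis
      by (simp add: coupling_D_def sum.distrib scaleR_add_right)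
  qed
  then have "tangent_D F x Bn Et En L C X \<alpha> q =
      (\<Sum>b\<in>UNIV. Et \<alpha> b q *\<^sub>R (\<Sum>\<gamma>\<in>UNIV. ?B b \<gamma> *\<^sub>R ext_d (X \<gamma>) q))
      + (\<Sum>b\<in>UNIV. Et \<alpha> b q *\<^sub>R (\<Sum>\<gamma>\<in>UNIV. X \<gamma> q *\<^sub>R (?R b \<gamma> + (\<Sum>f\<in>UNIV. ?B f \<gamma> *\<^sub>R ?cf b f))))"
    by (simp add: tangent_D_def sum.distrib scaleR_add_right)
  also have "(\<Sum>b\<in>UNIV. Et \<alpha> b q *\<^sub>R (\<Sum>\<gamma>\<in>UNIV. ?B b \<gamma> *\<^sub>R ext_d (X \<gamma>) q)) =
      (\<Sum>\<gamma>\<in>UNIV. (\<Sum>b\<in>UNIV. ?B b \<gamma> * Et \<alpha> b q) *\<^sub>R ext_d (X \<gamma>) q)"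
    unfolding scaleR_sum_left scaleR_sum_right
    by (subst sum.swap) (simp add: mult.commute)
  also have "\<dots> = ext_d (X \<alpha>) q"
    by (simp add: dual if_distrib[of "\<lambda>r. r *\<^sub>R _"] cong: if_cong)
  also have "(\<Sum>b\<in>UNIV. Et \<alpha> b q *\<^sub>R (\<Sum>\<gamma>\<in>UNIV. X \<gamma> q *\<^sub>R (?R b \<gamma> + (\<Sum>f\<in>UNIV. ?B f \<gamma> *\<^sub>R ?cf b f)))) =
      (\<Sum>\<gamma>\<in>UNIV. X \<gamma> q *\<^sub>R tangent_form F x Bn Et En L C \<alpha> \<gamma> q)"
  proof -
    have "(\<Sum>b\<in>UNIV. Et \<alpha> b q *\<^sub>R (\<Sum>\<gamma>\<in>UNIV. X \<gamma> q *\<^sub>R Y b \<gamma>)) =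
        (\<Sum>\<gamma>\<in>UNIV. X \<gamma> q *\<^sub>R (\<Sum>b\<in>UNIV. Et \<alpha> b q *\<^sub>R Y b \<gamma>))"
      for Y :: "'n \<Rightarrow> 'm \<Rightarrow> 'm tpt \<Rightarrow>\<^sub>L real"
      unfolding scaleR_sum_right by (subst sum.swap) (simp add: mult.commute)
    then show ?thesis
      unfolding tangent_form_altdef .
  qed
  finally show ?thesis .
qed

lemma connection_forms_unique:
  assumes "connection_forms W D \<omega>" and "connection_forms W D \<omega>'" and "q \<in> W"
  shows "\<omega> \<alpha> \<beta> q = \<omega>' \<alpha> \<beta> q"
proof -
  let ?X = "\<lambda>\<gamma> _. if \<gamma> = \<beta> then 1 else 0"
  have val: "D ?X \<alpha> q = \<theta> \<alpha> \<beta> q" if "connection_forms W D \<theta>" for \<theta>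
  proof -
    have "D ?X \<alpha> q = ext_d (?X \<alpha>) q + (\<Sum>\<gamma>\<in>UNIV. ?X \<gamma> q *\<^sub>R \<theta> \<alpha> \<gamma> q)"
      using that[unfolded connection_forms_def, THEN spec, of ?X] smooth_on_const assms(3) by blast
    also have "\<dots> = \<theta> \<alpha> \<beta> q"
      by (simp add: if_distrib[of "\<lambda>r. r *\<^sub>R _"] cong: if_cong)
    finally show ?thesis .
  qed
  show ?thesis
    using val[OF assms(1)] val[OF assms(2)] by simp
qed

lemma connection_forms_tangent_D_iff:
  fixes x :: "real^'m::finite \<Rightarrow> real^'n::finite"
  assumes S: "open S" "smooth_on S x" and W: "open W" "W \<subseteq> S \<times> T" and frame: "moving_frame W x Bn Et En"
  shows "connection_forms W (tangent_D F x Bn Et En L C) \<omega> \<longleftrightarrow>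
    (\<forall>q\<in>W. \<forall>\<alpha> \<beta>. \<omega> \<alpha> \<beta> q = tangent_form F x Bn Et En L C \<alpha> \<beta> q)"
proof -
  have Ck: "Ck_on 2 S (\<lambda>u. x u $ a)" for a
    using S by (auto intro: Ck_on_bounded_linear[OF bounded_linear_vec_nth] simp: smooth_on_def)
  have B: "Bt x a \<gamma> differentiable at u" if "u \<in> S" for a \<gamma> u
    using Ck[of a] S(1) that
    by (auto simp: numeral_2_eq_2 Bt_def[abs_def] pd_def intro: differentiable_on_openD)
  have Bt2_commute: "Bt2 x a \<beta> \<delta> u = Bt2 x a \<delta> \<beta> u" if "u \<in> S" for a \<beta> \<delta> u
    using frechet_derivative_commute[OF S(1) Ck that] by (simp add: Bt2_def pd_def[abs_def])
  have "connection_forms W (tangent_D F x Bn Et En L C) (tangent_form F x Bn Et En L C)"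
    unfolding connection_forms_def
  proof (intro allI impI ballI tangent_D_eq)
    fix X :: "'m \<Rightarrow> 'm tpt \<Rightarrow> real" and q \<alpha> \<beta> \<gamma> a \<delta>
    assume X: "\<forall>\<gamma>. smooth_on W (X \<gamma>)" and q: "q \<in> W"
    then have "fst q \<in> S"
      using W(2) by auto
    then show "Bt x a \<gamma> differentiable at (fst q)" "Bt2 x a \<beta> \<delta> (fst q) = Bt2 x a \<delta> \<beta> (fst q)"
      by (rule B, rule Bt2_commute)
    have "Ck_on (Suc 0) W (X \<gamma>)"
      using X by (simp add: smooth_on_def)
    then show "X \<gamma> differentiable at q"
      using W(1) q by (auto intro: differentiable_on_openD)
    show "(\<Sum>a\<in>UNIV. Bt x a \<beta> (fst q) * Et \<alpha> a q) = (if \<alpha> = \<beta> then 1 else 0)"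
      using frame q by (simp add: moving_frame_def)
  qed
  moreover from this have "connection_forms W (tangent_D F x Bn Et En L C) \<omega>"
    if "\<forall>q\<in>W. \<forall>\<alpha> \<beta>. \<omega> \<alpha> \<beta> q = tangent_form F x Bn Et En L C \<alpha> \<beta> q"
    using that by (simp add: connection_forms_def)
  ultimately show ?thesis
    using connection_forms_unique by metis
qed

theorem theorem2p3:
  fixes A :: "('p::{t2_space, second_countable_topology}, 'n::finite) chart set"
    and A' :: "('q::{t2_space, second_countable_topology}, 'm::finite) chart set"
    and F :: "('p, 'n) chart \<Rightarrow> 'n tpt \<Rightarrow> real"
    and i :: "'q \<Rightarrow> 'p"
    and p :: real
    and c :: "('p, 'n) chart" and c' :: "('q, 'm) chart"
    and x :: "real^'m \<Rightarrow> real^'n"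
    and Fc :: "'n tpt \<Rightarrow> real"
    and W :: "'m tpt set"
    and Bn :: "'n \<Rightarrow> 'k::finite \<Rightarrow> 'm tpt \<Rightarrow> real"
    and Et :: "'m \<Rightarrow> 'n \<Rightarrow> 'm tpt \<Rightarrow> real"
    and En :: "'k \<Rightarrow> 'n \<Rightarrow> 'm tpt \<Rightarrow> real"
    and \<omega>H \<omega>V :: "'m \<Rightarrow> 'm \<Rightarrow> 'm oneform"
  assumes "1 < CARD('m)" and "CARD('m) < CARD('n)" and "CARD('k) = CARD('n) - CARD('m)"
    and "finsler_space A F"
    and "smooth_atlas A'" and "immersion A' A i"
    and "p > 0"
    and "c \<in> A" and "c' \<in> A'"
    and "Fc = F c" and "x = local_rep c' c i"
    and "open W" and "W \<subseteq> local_dom c' c i \<times> (- {0})"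
    and "moving_frame W x Bn Et En"
  shows "(connection_forms W (tangent_D Fc x Bn Et En (cartan_LH Fc) (cartan_CH Fc)) \<omega>H \<longleftrightarrow>
      (\<forall>q\<in>W. \<forall>\<alpha> \<beta>. \<omega>H \<alpha> \<beta> q =
        (\<Sum>\<delta>\<in>UNIV.
           (\<Sum>d\<in>UNIV. Et \<alpha> d q * (Bt2 x d \<beta> \<delta> (fst q) +
              (\<Sum>f\<in>UNIV. Bt x f \<beta> (fst q) *
                 coupling_L Fc x Bn En (cartan_LH Fc) (cartan_CH Fc) d f \<delta> q))) *\<^sub>R du \<delta> q
         + (\<Sum>d\<in>UNIV. \<Sum>f\<in>UNIV. Et \<alpha> d q * Bt x f \<beta> (fst q) *
              coupling_C x (cartan_CH Fc) d f \<delta> q) *\<^sub>R delta_v Fc x Et \<delta> q)))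
    \<and>
    (connection_forms W (tangent_D Fc x Bn Et En (cartan_LV Fc p) (cartan_CV Fc p)) \<omega>V \<longleftrightarrow>
      (\<forall>q\<in>W. \<forall>\<alpha> \<beta>. \<omega>V \<alpha> \<beta> q =
        (\<Sum>\<delta>\<in>UNIV.
           (\<Sum>d\<in>UNIV. Et \<alpha> d q * (Bt2 x d \<beta> \<delta> (fst q) +
              (\<Sum>f\<in>UNIV. Bt x f \<beta> (fst q) *
                 coupling_L Fc x Bn En (cartan_LV Fc p) (cartan_CV Fc p) d f \<delta> q))) *\<^sub>R du \<delta> q
         + (\<Sum>d\<in>UNIV. \<Sum>f\<in>UNIV. Et \<alpha> d q * Bt x f \<beta> (fst q) *
              coupling_C x (cartan_CV Fc p) d f \<delta> q) *\<^sub>R delta_v Fc x Et \<delta> q)))"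
proof -
  have "is_chart c" "is_chart c'"
    using assms(4,5,8,9) by (auto simp: finsler_space_def smooth_atlas_def)
  moreover have "continuous_on UNIV i" "smooth_on (local_dom c' c i) x"
    using assms(6,8,9,11) by (auto simp: immersion_def)
  ultimately have "open (local_dom c' c i)" "smooth_on (local_dom c' c i) x"
    by (auto intro: open_local_dom)
  from connection_forms_tangent_D_iff[OF this assms(12-14)] show ?thesis
    unfolding tangent_form_def by blast
qed

end
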